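(* Let $\alpha=(\alpha_1,\alpha_2,\alpha_3)\in\mathbb C^3\setminus\{0\}$ and let $$M_\alpha=\{z\in\mathbb D^3:\ \alpha_1 z_1+\alpha_2 z_2+\alpha_3 z_3=\bar\alpha_3 z_1z_2+\bar\alpha_2 z_1z_3+\bar\alpha_1 z_2z_3\}.$$ Then $M_\alpha$ is a Carathéodory set in $\mathbb D^3$. Moreover, $l_{M_\alpha}(z,w)=c_{M_\alpha}(z,w)=c_{\mathbb D^3}(z,w)$ for all $z,w\in M_\alpha$.
   Context: $\mathbb D=\{\lambda\in\mathbb C:|\lambda|<1\}$ and $\rho$ is the hyperbolic (Poincaré) distance on $\mathbb D$, $\rho(\lambda,\mu)=\operatorname{artanh}\left|\frac{\lambda-\mu}{1-\bar\lambda\mu}\right|$. For a subset $V$ of a domain $D\subset\mathbb C^n$, a function $f:V\to\mathbb C$ is holomorphic if every $w\in V$ has an open neighborhood $W$ in $D$ and a holomorphic $g:W\to\mathbb C$ with $f=g$ on $V\cap W$; $\mathcal O(V,\mathbb D)$ denotes the set of holomorphic functions on $V$ with values in $\mathbb D$. The Carathéodory pseudodistance of $V$ is $c_V(z,w)=\sup\{\rho(F(z),F(w)):F\in\mathcal O(V,\mathbb D)\}$ (with $V=D$ this defines $c_D$). The Lempert function of $V$ is $l_V(w,z)=\inf\{\rho(0,t): t\in\mathbb D$ and there is a holomorphic $f:\mathbb D\to\mathbb C^n$ with $f(\mathbb D)\subset V$, $f(0)=w$, $f(t)=z\}$, with $l_V(w,z)=\infty$ if no such $f$ exists. An analytic subset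 $V$ of a domain $D$ is a Carathéodory set (in $D$) if $c_D(z,w)=c_V(z,w)$ for all $z,w\in V$. *)

theory Defs
  imports "HOL-Complex_Analysis.Complex_Analysis"
begin

abbreviation unit_disc :: "complex set" where
  "unit_disc \<equiv> ball 0 1"

definition polydisc :: "(complex ^ 'n) set" where
  "polydisc = {z. \<forall>i. z $ i \<in> unit_disc}"

definition poincare_dist :: "complex \<Rightarrow> complex \<Rightarrow> real" where
  "poincare_dist l m = artanh (cmod ((l - m) / (1 - cnj l * m)))"

(* Holomorphy in several variables: real Frechet differentiability with a
   complex-linear derivative; intended for open W. *)
definition mv_holomorphic_on :: "(complex ^ 'n \<Rightarrow> complex) \<Rightarrow> (complex ^ 'n) set \<Rightarrow> bool" where
  "mv_holomorphic_on g W \<longleftrightarrow>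
     (\<forall>x\<in>W. \<exists>L. (g has_derivative L) (at x) \<and> (\<forall>c v. L (c *s v) = c * L v))"

(* In the following definitions D is the ambient domain and V a subset of it. Only the
   values of f on V matter. *)
definition holomorphic_on_subset ::
    "(complex ^ 'n) set \<Rightarrow> (complex ^ 'n) set \<Rightarrow> (complex ^ 'n \<Rightarrow> complex) \<Rightarrow> bool" where
  "holomorphic_on_subset D V f \<longleftrightarrow>
     (\<forall>w\<in>V. \<exists>W g. open W \<and> w \<in> W \<and> W \<subseteq> D \<and> mv_holomorphic_on g W \<and> (\<forall>x\<in>V \<inter> W. f x = g x))"

definition hol_to_disc ::
    "(complex ^ 'n) set \<Rightarrow> (complex ^ 'n) set \<Rightarrow> (complex ^ 'n \<Rightarrow> complex) set" where
  "hol_to_disc D V = {f. holomorphic_on_subset D V f \<and> f ` V \<subseteq> unit_disc}"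

(* The distances are extended reals: a supremum may be infinite, and the infimum of the
   empty set is infinity. The pseudodistance of D itself is caratheodory_dist D D. *)
definition caratheodory_dist ::
    "(complex ^ 'n) set \<Rightarrow> (complex ^ 'n) set \<Rightarrow> complex ^ 'n \<Rightarrow> complex ^ 'n \<Rightarrow> ereal" where
  "caratheodory_dist D V z w = (SUP F\<in>hol_to_disc D V. ereal (poincare_dist (F z) (F w)))"

definition lempert_fun ::
    "(complex ^ 'n) set \<Rightarrow> complex ^ 'n \<Rightarrow> complex ^ 'n \<Rightarrow> ereal" where
  "lempert_fun V w z =
     Inf {ereal (poincare_dist 0 t) | t. t \<in> unit_disc \<and>
       (\<exists>f :: complex \<Rightarrow> complex ^ 'n.
          (\<forall>i. (\<lambda>s. f s $ i) holomorphic_on unit_disc) \<and>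
          f ` unit_disc \<subseteq> V \<and> f 0 = w \<and> f t = z)}"

(* Locally, around every point of D (not only of V), V is the common zero set of finitely
   many holomorphic functions; in particular V is relatively closed in D. *)
definition analytic_subset :: "(complex ^ 'n) set \<Rightarrow> (complex ^ 'n) set \<Rightarrow> bool" where
  "analytic_subset D V \<longleftrightarrow> V \<subseteq> D \<and>
     (\<forall>a\<in>D. \<exists>U G. open U \<and> a \<in> U \<and> U \<subseteq> D \<and> finite G \<and>
        (\<forall>g\<in>G. mv_holomorphic_on g U) \<and> V \<inter> U = {z\<in>U. \<forall>g\<in>G. g z = 0})"

definition caratheodory_set :: "(complex ^ 'n) set \<Rightarrow> (complex ^ 'n) set \<Rightarrow> bool" where
  "caratheodory_set D V \<longleftrightarrow>
     open D \<and> connected D \<and> D \<noteq> {} \<and> analytic_subset D V \<and>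
     (\<forall>z\<in>V. \<forall>w\<in>V. caratheodory_dist D D z w = caratheodory_dist D V z w)"

definition M_set :: "complex ^ 3 \<Rightarrow> (complex ^ 3) set" where
  "M_set \<alpha> = {z \<in> polydisc.
     \<alpha> $ 1 * z $ 1 + \<alpha> $ 2 * z $ 2 + \<alpha> $ 3 * z $ 3 =
     cnj (\<alpha> $ 3) * z $ 1 * z $ 2 + cnj (\<alpha> $ 2) * z $ 1 * z $ 3 + cnj (\<alpha> $ 1) * z $ 2 * z $ 3}"

end

theory Submission
  imports Defs
begin

text \<open>
  The point is that any two points z, w of the variety lie on an analytic disc f in it with f(0) = z and
  f(t) = w, where the distance of 0 and t is the largest of the coordinate distances of z and w;
  the chain Lempert function \<open>\<le>\<close> coordinate distance \<open>\<le>\<close> Caratheodory distance of the polydisc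
  \<open>\<le>\<close> Caratheodory distance of the variety \<open>\<le>\<close> Lempert function then consists of equalities.

  The variety is the zero set of a trilinear polynomial Q with
  \<open>x y z \<cdot> cnj (Q (1/cnj x, 1/cnj y, 1/cnj z)) = - Q\<close>, a class stable under Moebius maps in each
  variable, so z may be moved to 0. If the third coordinate of w is the largest, seek f of the form
  \<open>(s h\<^sub>1(s), s h\<^sub>2(s), s)\<close>; then Q(f(s))/s is again such a polynomial R in \<open>(h\<^sub>1, h\<^sub>2, s)\<close>, and it must
  vanish identically with \<open>h\<^sub>1, h\<^sub>2\<close> prescribed at one point. If the prescribed values are in the open
  disc, this point is moved to 0 as well and R becomes
  \<open>g\<^sub>1 x + g\<^sub>2 y + g\<^sub>3 s - cnj g\<^sub>3 x y - cnj g\<^sub>2 x s - cnj g\<^sub>1 y s\<close>. When the \<open>\<bar>g\<^sub>i\<bar>\<close> satisfy the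
  triangle inequalities, there are unimodular u, v with \<open>g\<^sub>1 u + g\<^sub>2 v + g\<^sub>3 = 0\<close> and (us, vs, s) is
  a solution; when \<open>\<bar>g\<^sub>1\<bar>\<close> or \<open>\<bar>g\<^sub>2\<bar>\<close> is too large, the zero set is a graph over the other two variables;
  and \<open>\<bar>g\<^sub>3\<bar>\<close> cannot be too large, because R does not depend on s at \<open>h\<^sub>1 = h\<^sub>2 = 0\<close>.
\<close>

section \<open>Disc automorphisms and the Poincare distance\<close>

text \<open>\<open>Moebius_function 0 w\<close> sends \<open>w\<close> to 0; with the sign flipped,
  0 goes to \<open>p\<close>, and for \<bar>p\<bar> < 1 the inverse on the disc is
  \<open>disc_shift (- p)\<close>.\<close>

abbreviation disc_shift :: "complex \<Rightarrow> complex \<Rightarrow> complex" where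
  "disc_shift p \<equiv> Moebius_function 0 (- p)"

lemma disc_shift_eq: "disc_shift p x = (x + p) / (1 + cnj p * x)"
  by (simp add: Moebius_function_simple)

lemma disc_shift_0: "disc_shift p 0 = p"
  by (simp add: disc_shift_eq)

lemma one_plus_cnj_mult_nonzero:
  assumes "cmod p < 1" "cmod x < 1"
  shows "1 + cnj p * x \<noteq> 0"
proof
  assume "1 + cnj p * x = 0"
  then have "cmod (cnj p * x) = 1"
    by (metis add_eq_0_iff norm_minus_cancel norm_one)
  moreover have "cmod (cnj p * x) < 1"
    using norm_mult_less[of "cnj p" 1 x 1] assms by simp
  ultimately show False by simp
qed

lemma disc_shift_minus:
  assumes "cmod p < 1" "cmod x < 1"
  shows "disc_shift p (disc_shift (- p) x) = x"
  using Moebius_function_compose[of "- p" p x] assms by simp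

lemma artanh_real_mono:
  fixes x y :: real
  assumes "0 \<le> x" "x \<le> y" "y < 1"
  shows "artanh x \<le> artanh y"
proof -
  have "(1 + x) / (1 - x) \<le> (1 + y) / (1 - y)"
    using assms by (intro frac_le) auto
  moreover have "0 < (1 + x) / (1 - x)" "0 < (1 + y) / (1 - y)"
    using assms by auto
  ultimately show ?thesis
    by (simp add: artanh_def)
qed

lemma poincare_dist_eq_disc_shift:
  "poincare_dist l m = artanh (cmod (disc_shift (- l) m))"
  unfolding poincare_dist_def disc_shift_eq by (simp add: norm_divide norm_minus_commute)

lemma poincare_dist_0: "poincare_dist 0 t = artanh (cmod t)"
  by (simp add: poincare_dist_def)

text \<open>Schwarz-Pick with base point 0: the Schwarz lemma applies once \<open>g 0\<close> is
  moved to 0 by an automorphism.\<close>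

lemma poincare_dist_holomorphic_le:
  assumes "g holomorphic_on unit_disc" "g ` unit_disc \<subseteq> unit_disc" "cmod t < 1"
  shows "poincare_dist (g 0) (g t) \<le> poincare_dist 0 t"
proof -
  define h where "h = disc_shift (- g 0) \<circ> g"
  have g: "cmod (g s) < 1" if "cmod s < 1" for s
    using assms(2) that by (auto simp: image_subset_iff)
  have "h holomorphic_on unit_disc"
    unfolding h_def
    by (rule holomorphic_on_compose_gen[OF assms(1) Moebius_function_holomorphic assms(2)])
      (simp add: g)
  moreover have "h 0 = 0"
    by (simp add: h_def Moebius_function_eq_zero)
  moreover have "cmod (h s) < 1" if "cmod s < 1" for s
    unfolding h_def o_def by (rule Moebius_function_norm_lt_1) (simp_all add: g that)
  ultimately have "cmod (h t) \<le> cmod t"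
    using Schwarz_Lemma(1)[of h t] assms(3) by blast
  then show ?thesis
    using assms(3) by (simp add: poincare_dist_eq_disc_shift[of "g 0"] poincare_dist_0 h_def artanh_real_mono)
qed

section \<open>Self-reflective trilinear polynomials and Moebius changes of variable\<close>

text \<open>The parameters are the coefficients of degree 0 and 1; the reflection symmetry of Q
  fixes the others. Permuting the variables permutes \<open>b1\<close>, \<open>b2\<close>,
  \<open>b3\<close>, and the equation of \<open>M_set\<close> is the case
  \<open>a = 0\<close>.\<close>

definition tri :: "complex \<Rightarrow> complex \<Rightarrow> complex \<Rightarrow> complex \<Rightarrow> complex \<Rightarrow> complex \<Rightarrow> complex \<Rightarrow> complex" where
  "tri a b1 b2 b3 x y z = a + b1 * x + b2 * y + b3 * z
     - (cnj b3 * x * y + cnj b2 * x * z + cnj b1 * y * z) - cnj a * x * y * z"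

lemma tri_swap12: "tri a b1 b2 b3 x y z = tri a b2 b1 b3 y x z"
  by (simp add: tri_def algebra_simps)

lemma tri_swap13: "tri a b1 b2 b3 x y z = tri a b3 b2 b1 z y x"
  by (simp add: tri_def algebra_simps)

text \<open>The degree in \<open>x\<close> is one, so a single factor clears the denominator. The
  class is preserved because disc automorphisms commute with the reflection x to 1 / cnj x.\<close>

lemma tri_disc_shift1:
  assumes "cmod p < 1" "cmod x < 1"
  shows "tri a b1 b2 b3 (disc_shift p x) y z * (1 + cnj p * x) =
    tri (a + p * b1) (b1 + cnj p * a) (b2 - p * cnj b3) (b3 - p * cnj b2) x y z"
proof -
  define d m where "d = 1 + cnj p * x" and "m = disc_shift p x"
  have "m * d = x + p"
    using one_plus_cnj_mult_nonzero[OF assms] by (simp add: disc_shift_eq d_def m_def)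
  have "tri a b1 b2 b3 m y z * d =
     (a + b2 * y + b3 * z - cnj b1 * y * z) * d + (b1 - cnj b3 * y - cnj b2 * z - cnj a * y * z) * (m * d)"
    by (simp add: tri_def algebra_simps)
  also note \<open>m * d = x + p\<close>
  finally show ?thesis
    by (simp add: d_def m_def tri_def algebra_simps)
qed

lemma tri_shift1_zeros:
  assumes "cmod p < 1"
  obtains a' b1' b2' b3' where "\<And>x y z. cmod x < 1 \<Longrightarrow>
    tri a b1 b2 b3 (disc_shift p x) y z = 0 \<longleftrightarrow> tri a' b1' b2' b3' x y z = 0"
proof
  show "tri a b1 b2 b3 (disc_shift p x) y z = 0 \<longleftrightarrow>
      tri (a + p * b1) (b1 + cnj p * a) (b2 - p * cnj b3) (b3 - p * cnj b2) x y z = 0"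
    if "cmod x < 1" for x y z
    using one_plus_cnj_mult_nonzero[OF assms that]
    by (simp flip: tri_disc_shift1[OF assms that])
qed

lemma tri_shift_zeros:
  assumes "cmod p < 1" "cmod q < 1" "cmod r < 1" "tri a b1 b2 b3 p q r = 0"
  obtains c1 c2 c3 where "\<And>x y z. cmod x < 1 \<Longrightarrow> cmod y < 1 \<Longrightarrow> cmod z < 1 \<Longrightarrow>
    tri a b1 b2 b3 (disc_shift p x) (disc_shift q y) (disc_shift r z) = 0 \<longleftrightarrow> tri 0 c1 c2 c3 x y z = 0"
proof -
  obtain a' b1' b2' b3' where 1: "\<And>x y z. cmod x < 1 \<Longrightarrow>
    tri a b1 b2 b3 (disc_shift p x) y z = 0 \<longleftrightarrow> tri a' b1' b2' b3' x y z = 0"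
    using tri_shift1_zeros[OF assms(1), of a b1 b2 b3] by metis
  obtain a'' b1'' b2'' b3'' where "\<And>x y z. cmod x < 1 \<Longrightarrow>
    tri a' b2' b1' b3' (disc_shift q x) y z = 0 \<longleftrightarrow> tri a'' b2'' b1'' b3'' x y z = 0"
    using tri_shift1_zeros[OF assms(2), of a' b2' b1' b3'] by metis
  then have 2: "tri a' b1' b2' b3' x (disc_shift q y) z = 0 \<longleftrightarrow> tri a'' b1'' b2'' b3'' x y z = 0"
    if "cmod y < 1" for x y z
    using that by (simp only: tri_swap12[of a' b1' b2'] tri_swap12[of a'' b1'' b2''])
  obtain d c1 c2 c3 where "\<And>x y z. cmod x < 1 \<Longrightarrow>
    tri a'' b3'' b2'' b1'' (disc_shift r x) y z = 0 \<longleftrightarrow> tri d c3 c2 c1 x y z = 0"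
    using tri_shift1_zeros[OF assms(3), of a'' b3'' b2'' b1''] by metis
  then have 3: "tri a'' b1'' b2'' b3'' x y (disc_shift r z) = 0 \<longleftrightarrow> tri d c1 c2 c3 x y z = 0"
    if "cmod z < 1" for x y z
    using that by (simp only: tri_swap13[of a'' b1'' b2''] tri_swap13[of d c1 c2])
  have eq: "tri a b1 b2 b3 (disc_shift p x) (disc_shift q y) (disc_shift r z) = 0 \<longleftrightarrow> tri d c1 c2 c3 x y z = 0"
    if "cmod x < 1" "cmod y < 1" "cmod z < 1" for x y z
    using that by (simp add: 1 2 3)
  \<comment> \<open>At the origin the left side is \<open>tri\<close> at the zero (p, q, r), and the
    right side is the constant coefficient \<open>d\<close>.\<close>
  from eq[of 0 0 0] assms(4) have "d = 0"
    by (simp add: disc_shift_eq tri_def)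
  then show thesis
    using eq that by blast
qed

section \<open>Inequalities between the linear coefficients\<close>

text \<open>A possibly degenerate triangle with the three moduli as side lengths exists. The
  intermediate value theorem on the circle gives \<open>u\<close> with \<bar>g3 + g1 u\<bar> =
  \<bar>g2\<bar>, and \<open>v\<close> then closes the triangle.\<close>

lemma exists_unimodular_relation:
  fixes g1 g2 g3 :: complex
  assumes "cmod g1 \<le> cmod g2 + cmod g3" "cmod g2 \<le> cmod g1 + cmod g3" "cmod g3 \<le> cmod g1 + cmod g2"
  obtains u v where "cmod u = 1" "cmod v = 1" "g1 * u + g2 * v + g3 = 0"
proof -
  have "\<exists>u. cmod u = 1 \<and> cmod (g3 + g1 * u) = cmod g2"
  proof (cases "g1 = 0 \<or> g3 = 0")
    case True
    with assms show ?thesis by (intro exI[of _ 1]) auto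
  next
    case False
    \<comment> \<open>\<open>s\<close> rotates \<open>g1\<close> into the direction of
      \<open>g3\<close>, so the modulus is largest at \<open>s\<close> and smallest at
      \<open>- s\<close>.\<close>
    define s where "s = sgn g3 / sgn g1"
    have s: "cmod s = 1"
      using False by (simp add: s_def norm_divide norm_sgn)
    have s13: "g1 * s = of_real (cmod g1) * sgn g3" "g3 = of_real (cmod g3) * sgn g3"
      using False by (auto simp: s_def sgn_eq)
    have plus: "cmod (g3 + g1 * s) = cmod g3 + cmod g1"
    proof -
      have "g3 + g1 * s = of_real (cmod g3 + cmod g1) * sgn g3"
        using s13 by (simp add: algebra_simps)
      then show ?thesis using False by (simp only: norm_mult norm_of_real norm_sgn) simp
    qed
    have minus: "cmod (g3 + g1 * (- s)) = \<bar>cmod g3 - cmod g1\<bar>"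
    proof -
      have "g3 + g1 * (- s) = of_real (cmod g3 - cmod g1) * sgn g3"
        using s13 by (simp add: algebra_simps)
      then show ?thesis using False by (simp only: norm_mult norm_of_real norm_sgn) simp
    qed
    have "connected ((\<lambda>u. cmod (g3 + g1 * u)) ` sphere 0 1)"
      by (intro connected_continuous_image continuous_intros connected_sphere) simp
    moreover have "\<bar>cmod g3 - cmod g1\<bar> \<in> (\<lambda>u. cmod (g3 + g1 * u)) ` sphere 0 1"
      using minus s by (intro image_eqI[of _ _ "- s"]) auto
    moreover have "cmod g3 + cmod g1 \<in> (\<lambda>u. cmod (g3 + g1 * u)) ` sphere 0 1"
      using plus s by (intro image_eqI[of _ _ s]) auto
    moreover have "\<bar>cmod g3 - cmod g1\<bar> \<le> cmod g2" "cmod g2 \<le> cmod g3 + cmod g1"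
      using assms by auto
    ultimately have "cmod g2 \<in> (\<lambda>u. cmod (g3 + g1 * u)) ` sphere 0 1"
      unfolding connected_iff_interval by blast
    then show ?thesis by auto
  qed
  then obtain u where u: "cmod u = 1" "cmod (g3 + g1 * u) = cmod g2" by blast
  show thesis
  proof (cases "g2 = 0")
    case True
    then show thesis using u that[of u 1] by (simp add: add.commute)
  next
    case False
    have "cmod (- (g3 + g1 * u) / g2) = 1"
      using u(2) False by (simp only: norm_divide norm_minus_cancel) simp
    then show thesis
      using u(1) False by (intro that[of u "- (g3 + g1 * u) / g2"]) auto
  qed
qed

text \<open>The two moduli belong to the coefficients of \<open>z\<close> and of 1 in
  \<open>tri 0 g1 g2 g3 x y z\<close>, which is affine in \<open>z\<close>.\<close>

lemma cmod_reflection_diff: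
  "(cmod (g3 - cnj g2 * x - cnj g1 * y))\<^sup>2 - (cmod (g1 * x + g2 * y - cnj g3 * x * y))\<^sup>2 =
    (cmod g3)\<^sup>2 * (1 - (cmod x)\<^sup>2 * (cmod y)\<^sup>2)
    + ((cmod g2)\<^sup>2 - (cmod g1)\<^sup>2) * ((cmod x)\<^sup>2 - (cmod y)\<^sup>2)
    - 2 * Re (g3 * g2 * cnj x) * (1 - (cmod y)\<^sup>2)
    - 2 * Re (g3 * g1 * cnj y) * (1 - (cmod x)\<^sup>2)"
  unfolding cmod_power2 by (simp add: algebra_simps power2_eq_square)

text \<open>If \<open>g3\<close> dominates, the affine equation for \<open>z\<close> has its root
  inside the disc, so the zero set is a graph over the first two variables.\<close>

lemma cmod_reflection_less:
  assumes g: "cmod g1 + cmod g2 < cmod g3" and x: "cmod x < 1" and y: "cmod y < 1"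
  shows "cmod (g1 * x + g2 * y - cnj g3 * x * y) < cmod (g3 - cnj g2 * x - cnj g1 * y)"
proof -
  define X Y a b c where "X = cmod x" and "Y = cmod y" and "a = cmod g1" and "b = cmod g2" and "c = cmod g3"
  have nonneg: "0 \<le> X" "0 \<le> Y" "0 \<le> a" "0 \<le> b" "X < 1" "Y < 1" "a + b < c"
    using assms by (auto simp: X_def Y_def a_def b_def c_def)
  have XY: "0 < 1 - X" "0 < 1 - Y" "0 < (1 - X) * (1 - Y)" "0 \<le> X * (1 - Y)" "0 \<le> Y * (1 - X)"
    using nonneg by auto
  have R: "Re (g3 * g2 * cnj x) \<le> c * b * X" "Re (g3 * g1 * cnj y) \<le> c * a * Y"
    using complex_Re_le_cmod[of "g3 * g2 * cnj x"] complex_Re_le_cmod[of "g3 * g1 * cnj y"]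
    by (simp_all add: norm_mult X_def Y_def a_def b_def c_def)
  have Z: "0 \<le> 1 - Y\<^sup>2" "0 \<le> 1 - X\<^sup>2"
    using nonneg by (simp_all add: power_le_one)
  \<comment> \<open>The product is the right side of \<open>cmod_reflection_diff\<close> with both
    real parts replaced by their upper bounds from \<open>R\<close>; only then does it
    factor.\<close>
  have "0 < (c * (1 + X * Y) - (a + b) * (X + Y)) * (c * (1 - X * Y) - (b - a) * (X - Y))"
  proof (rule mult_pos_pos)
    have "(a + b) * (X + Y) \<le> (a + b) * (1 + X * Y)"
      using nonneg XY by (intro mult_left_mono) (auto simp: algebra_simps)
    also have "\<dots> < c * (1 + X * Y)"
      using nonneg by (intro mult_strict_right_mono) (auto intro: add_pos_nonneg)
    finally show "0 < c * (1 + X * Y) - (a + b) * (X + Y)" by simp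
    have "(b - a) * (X - Y) \<le> \<bar>b - a\<bar> * \<bar>X - Y\<bar>"
      by (metis abs_ge_self abs_mult)
    also have "\<dots> \<le> (a + b) * (1 - X * Y)"
      using nonneg XY by (intro mult_mono) (auto simp: abs_le_iff algebra_simps)
    also have "\<dots> < c * (1 - X * Y)"
      using nonneg XY by (intro mult_strict_right_mono) (auto simp: algebra_simps)
    finally show "0 < c * (1 - X * Y) - (b - a) * (X - Y)" by simp
  qed
  also have "\<dots> = c\<^sup>2 * (1 - X\<^sup>2 * Y\<^sup>2) + (b\<^sup>2 - a\<^sup>2) * (X\<^sup>2 - Y\<^sup>2)
      - 2 * (c * b * X) * (1 - Y\<^sup>2) - 2 * (c * a * Y) * (1 - X\<^sup>2)"
    by (simp add: algebra_simps power2_eq_square)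
  also have "\<dots> \<le> c\<^sup>2 * (1 - X\<^sup>2 * Y\<^sup>2) + (b\<^sup>2 - a\<^sup>2) * (X\<^sup>2 - Y\<^sup>2)
      - 2 * Re (g3 * g2 * cnj x) * (1 - Y\<^sup>2) - 2 * Re (g3 * g1 * cnj y) * (1 - X\<^sup>2)"
    using mult_right_mono[OF R(1) Z(1)] mult_right_mono[OF R(2) Z(2)] by linarith
  also have "\<dots> = (cmod (g3 - cnj g2 * x - cnj g1 * y))\<^sup>2 - (cmod (g1 * x + g2 * y - cnj g3 * x * y))\<^sup>2"
    unfolding cmod_reflection_diff X_def Y_def a_def b_def c_def by simp
  finally have "(cmod (g1 * x + g2 * y - cnj g3 * x * y))\<^sup>2 < (cmod (g3 - cnj g2 * x - cnj g1 * y))\<^sup>2"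
    by simp
  then show ?thesis
    by (rule power_less_imp_less_base) simp
qed

section \<open>Discs in the zero set through the origin\<close>

text \<open>When \<open>g1\<close> dominates, the equation can be solved for the first variable; the
  disc is this graph over \<open>y = 0\<close>.\<close>

lemma tri_graph_disc:
  assumes "cmod g2 + cmod g3 < cmod g1"
  obtains f where "f holomorphic_on unit_disc" "f 0 = 0"
    "\<And>s. cmod s < 1 \<Longrightarrow> cmod (f s) < 1" "\<And>s. cmod s < 1 \<Longrightarrow> tri 0 g1 g2 g3 (f s) 0 s = 0"
proof -
  define f where "f s = - g3 * s / (g1 - cnj g2 * s)" for s
  have ineq: "cmod (g3 * s) < cmod (g1 - cnj g2 * s)" if "cmod s < 1" for s
  proof -
    have "cmod (g3 * s) \<le> cmod g3" "cmod (cnj g2 * s) \<le> cmod g2"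
      using that by (auto simp: norm_mult intro: mult_left_le)
    then show ?thesis
      using assms norm_triangle_ineq2[of g1 "cnj g2 * s"] by linarith
  qed
  then have nz: "g1 - cnj g2 * s \<noteq> 0" if "cmod s < 1" for s
    using that by force
  show thesis
  proof
    show "f holomorphic_on unit_disc"
      unfolding f_def using nz by (intro holomorphic_intros) auto
    show "cmod (f s) < 1" if "cmod s < 1" for s
      using ineq[OF that] nz[OF that] by (simp add: f_def norm_divide norm_mult divide_simps)
    show "tri 0 g1 g2 g3 (f s) 0 s = 0" if "cmod s < 1" for s
      using nz[OF that] by (simp add: f_def tri_def divide_simps) (simp add: algebra_simps)
  qed (simp add: f_def)
qed

text \<open>The hypothesis is forced: differentiating the equation at 0 gives g1 f1'(0) + g2 f2'(0)
  + g3 = 0, with derivatives of modulus at most 1 by Schwarz.\<close>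

lemma tri_disc_through_origin:
  assumes "cmod g3 \<le> cmod g1 + cmod g2"
  obtains f1 f2 where "f1 holomorphic_on unit_disc" "f2 holomorphic_on unit_disc" "f1 0 = 0" "f2 0 = 0"
    "\<And>s. cmod s < 1 \<Longrightarrow> cmod (f1 s) < 1" "\<And>s. cmod s < 1 \<Longrightarrow> cmod (f2 s) < 1"
    "\<And>s. cmod s < 1 \<Longrightarrow> tri 0 g1 g2 g3 (f1 s) (f2 s) s = 0"
proof -
  consider "cmod g2 + cmod g3 < cmod g1" | "cmod g1 + cmod g3 < cmod g2"
    | "cmod g1 \<le> cmod g2 + cmod g3" "cmod g2 \<le> cmod g1 + cmod g3"
    by linarith
  then show thesis
  proof cases
    case 1
    then obtain f where "f holomorphic_on unit_disc" "f 0 = 0"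
      "\<And>s. cmod s < 1 \<Longrightarrow> cmod (f s) < 1" "\<And>s. cmod s < 1 \<Longrightarrow> tri 0 g1 g2 g3 (f s) 0 s = 0"
      using tri_graph_disc by metis
    then show thesis by (intro that[of f "\<lambda>_. 0"]) auto
  next
    case 2
    then obtain f where "f holomorphic_on unit_disc" "f 0 = 0"
      "\<And>s. cmod s < 1 \<Longrightarrow> cmod (f s) < 1" "\<And>s. cmod s < 1 \<Longrightarrow> tri 0 g2 g1 g3 (f s) 0 s = 0"
      using tri_graph_disc by metis
    then show thesis by (intro that[of "\<lambda>_. 0" f]) (auto simp: tri_swap12[of 0 g1])
  next
    case 3
    with assms obtain u v where uv: "cmod u = 1" "cmod v = 1" "g1 * u + g2 * v + g3 = 0"
      using exists_unimodular_relation by metis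
    have "u * cnj u = 1" "v * cnj v = 1"
      using uv by (simp_all add: complex_norm_square[symmetric])
    moreover have "cnj g1 * cnj u + cnj g2 * cnj v + cnj g3 = 0"
      using arg_cong[OF uv(3), of cnj] by simp
    \<comment> \<open>The left side is \<open>u * v\<close> times the conjugated relation; up to
      sign it is the coefficient of s^2 along the disc, and the relation itself is that of
      s.\<close>
    ultimately have "cnj g3 * u * v + cnj g2 * u + cnj g1 * v = 0"
      by algebra
    then have "tri 0 g1 g2 g3 (u * s) (v * s) s = 0" for s
      using uv(3) unfolding tri_def by (simp only: complex_cnj_zero) algebra
    then show thesis
      using uv by (intro that[of "\<lambda>s. u * s" "\<lambda>s. v * s"]) (auto simp: norm_mult intro!: holomorphic_intros)
  qed
qed


section \<open>Interpolation in the zero set at one point\<close>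

text \<open>With \<open>c1\<close> unimodular and \<open>u = b3 + b1 * c1\<close>, the equation for \<open>y = h s\<close> reads
  \<open>b2 * y + u = s * c1 * (cnj u * y + cnj b2)\<close>: either its solution is a Blaschke factor or both sides
  vanish at \<open>y = c2\<close>.\<close>
lemma tri_interpolation_unimodular:
  assumes c1: "cmod c1 = 1" and c2: "cmod c2 \<le> 1" and t: "cmod t < 1"
    and zero: "tri b3 b1 b2 0 c1 c2 t = 0"
  obtains h where "h holomorphic_on unit_disc" "h t = c2"
    "\<And>s. cmod s < 1 \<Longrightarrow> cmod (h s) \<le> 1" "\<And>s. cmod s < 1 \<Longrightarrow> tri b3 b1 b2 0 c1 (h s) s = 0"
proof -
  define u where "u = b3 + b1 * c1"
  have c1_cnj: "c1 * cnj c1 = 1"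
    using c1 by (simp add: complex_norm_square[symmetric])
  have tri_u: "tri b3 b1 b2 0 c1 y s = b2 * y + u - s * c1 * (cnj u * y + cnj b2)" for y s
  proof -
    have "c1 * (cnj u * y) = c1 * cnj b3 * y + cnj b1 * y"
      using c1_cnj unfolding u_def complex_cnj_add complex_cnj_mult by algebra
    then show ?thesis
      by (simp add: tri_def u_def algebra_simps)
  qed
  show thesis
  proof (cases "cmod u < cmod b2")
    case True
    define h where "h s = (s * c1 * cnj b2 - u) / (b2 - s * c1 * cnj u)" for s
    have nz: "b2 - s * c1 * cnj u \<noteq> 0" if "cmod s < 1" for s
    proof -
      have "cmod (s * c1 * cnj u) \<le> cmod u"
        using that c1 by (simp add: norm_mult mult_left_le_one_le)
      then show ?thesis using True by force
    qed
    show thesis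
    proof
      show "h holomorphic_on unit_disc"
        unfolding h_def using nz by (intro holomorphic_intros) auto
      show "h t = c2"
        using zero nz[OF t] unfolding tri_u h_def by (simp add: divide_simps) (simp add: algebra_simps)
      show "tri b3 b1 b2 0 c1 (h s) s = 0" if "cmod s < 1" for s
        using nz[OF that] unfolding tri_u h_def by (simp add: divide_simps) (simp add: algebra_simps)
      show "cmod (h s) \<le> 1" if s: "cmod s < 1" for s
      proof -
        have "(cmod (b2 - s * c1 * cnj u))\<^sup>2 - (cmod (s * c1 * cnj b2 - u))\<^sup>2
          = ((cmod b2)\<^sup>2 - (cmod u)\<^sup>2) * (1 - (cmod (s * c1))\<^sup>2)"
          unfolding cmod_power2 by (simp add: algebra_simps power2_eq_square)
        moreover have "0 \<le> ((cmod b2)\<^sup>2 - (cmod u)\<^sup>2) * (1 - (cmod (s * c1))\<^sup>2)"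
          using True s c1 by (intro mult_nonneg_nonneg) (auto simp: norm_mult power_le_one intro!: power_mono)
        ultimately have "(cmod (s * c1 * cnj b2 - u))\<^sup>2 \<le> (cmod (b2 - s * c1 * cnj u))\<^sup>2"
          by linarith
        then have "cmod (s * c1 * cnj b2 - u) \<le> cmod (b2 - s * c1 * cnj u)"
          by (rule power2_le_imp_le) simp
        then show ?thesis
          using nz[OF s] by (simp add: h_def norm_divide divide_simps)
      qed
    qed
  next
    case False
    \<comment> \<open>The equation at the given point reads \<open>A = t * c1 * B\<close>, while
      \<bar>B\<bar> \<le> \<bar>A\<bar> in this case. Since \<bar>t\<bar> < 1, both vanish, and the
      constant \<open>c2\<close> solves the equation for every \<open>s\<close>.\<close>
    define A B where "A = b2 * c2 + u" and "B = cnj u * c2 + cnj b2"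
    have "(cmod A)\<^sup>2 - (cmod B)\<^sup>2 = ((cmod u)\<^sup>2 - (cmod b2)\<^sup>2) * (1 - (cmod c2)\<^sup>2)"
      unfolding A_def B_def cmod_power2 by (simp add: algebra_simps power2_eq_square)
    moreover have "0 \<le> ((cmod u)\<^sup>2 - (cmod b2)\<^sup>2) * (1 - (cmod c2)\<^sup>2)"
      using False c2 by (intro mult_nonneg_nonneg) (auto simp: power_le_one intro!: power_mono)
    ultimately have "(cmod B)\<^sup>2 \<le> (cmod A)\<^sup>2"
      by linarith
    then have BA: "cmod B \<le> cmod A"
      by (rule power2_le_imp_le) simp
    have AB: "A = t * c1 * B"
      using zero unfolding tri_u A_def B_def by simp
    then have "cmod A = cmod t * cmod B"
      using c1 by (simp add: norm_mult)
    then have "cmod B * (1 - cmod t) \<le> 0"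
      using BA by (simp add: algebra_simps)
    then have "B = 0"
      using t by (simp add: mult_le_0_iff)
    then have "A = 0" using AB by simp
    show thesis
      using \<open>A = 0\<close> \<open>B = 0\<close> c2 unfolding A_def B_def
      by (intro that[of "\<lambda>_. c2"]) (auto simp: tri_u)
  qed
qed

lemma tri_interpolation_interior:
  assumes c1: "cmod c1 < 1" and c2: "cmod c2 < 1" and t: "cmod t < 1"
    and zero: "tri b3 b1 b2 0 c1 c2 t = 0"
  obtains h1 h2 where "h1 holomorphic_on unit_disc" "h2 holomorphic_on unit_disc" "h1 t = c1" "h2 t = c2"
    "\<And>s. cmod s < 1 \<Longrightarrow> cmod (h1 s) \<le> 1" "\<And>s. cmod s < 1 \<Longrightarrow> cmod (h2 s) \<le> 1"
    "\<And>s. cmod s < 1 \<Longrightarrow> tri b3 b1 b2 0 (h1 s) (h2 s) s = 0"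
proof -
  obtain g1 g2 g3 where g: "\<And>x y z. cmod x < 1 \<Longrightarrow> cmod y < 1 \<Longrightarrow> cmod z < 1 \<Longrightarrow>
    tri b3 b1 b2 0 (disc_shift c1 x) (disc_shift c2 y) (disc_shift t z) = 0 \<longleftrightarrow> tri 0 g1 g2 g3 x y z = 0"
    using tri_shift_zeros[OF c1 c2 t zero] by metis
  have "cmod g3 \<le> cmod g1 + cmod g2"
  proof (rule ccontr)
    assume less: "\<not> ?thesis"
    \<comment> \<open>In the shifted coordinates (- c1, - c2) is the old point (0, 0), and
      \<open>P + Q * z\<close> is the shifted polynomial on the line over it.\<close>
    define P Q where "P = g1 * (- c1) + g2 * (- c2) - cnj g3 * (- c1) * (- c2)"
      and "Q = g3 - cnj g2 * (- c1) - cnj g1 * (- c2)"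
    have PQ: "cmod P < cmod Q"
      unfolding P_def Q_def using less c1 c2 by (intro cmod_reflection_less) auto
    then have "Q \<noteq> 0" by auto
    have line: "tri b3 b1 b2 0 0 0 (disc_shift t z) = 0 \<longleftrightarrow> P + Q * z = 0" if "cmod z < 1" for z
      using g[of "- c1" "- c2" z] c1 c2 that
      by (simp add: Moebius_function_eq_zero tri_def P_def Q_def algebra_simps)
    \<comment> \<open>On this line the original polynomial is the constant \<open>b3\<close>. A root
      in the disc forces \<open>b3 = 0\<close>, so the affine function vanishes on the whole disc,
      contradicting \<open>Q \<noteq> 0\<close>.\<close>
    have "cmod (- P / Q) < 1" "P + Q * (- P / Q) = 0"
      using PQ \<open>Q \<noteq> 0\<close> by (simp_all add: norm_divide)
    then have "b3 = 0"
      using line[of "- P / Q"] by (simp add: tri_def)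
    then have "P + Q * 0 = 0" "P + Q * (1/2) = 0"
      using line[of 0] line[of "1/2"] by (simp_all add: tri_def)
    then show False using \<open>Q \<noteq> 0\<close> by simp
  qed
  then obtain f1 f2 where f: "f1 holomorphic_on unit_disc" "f2 holomorphic_on unit_disc" "f1 0 = 0" "f2 0 = 0"
    and f1: "\<And>s. cmod s < 1 \<Longrightarrow> cmod (f1 s) < 1" and f2: "\<And>s. cmod s < 1 \<Longrightarrow> cmod (f2 s) < 1"
    and fz: "\<And>s. cmod s < 1 \<Longrightarrow> tri 0 g1 g2 g3 (f1 s) (f2 s) s = 0"
    using tri_disc_through_origin by metis
  \<comment> \<open>Reparametrising by \<open>m\<close> puts the base point of the discs at
    \<open>s = t\<close>, where the shifts by \<open>c1\<close> and \<open>c2\<close> give the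
    prescribed values.\<close>
  define m where "m = disc_shift (- t)"
  have m: "cmod (m s) < 1" "disc_shift t (m s) = s" if "cmod s < 1" for s
    using Moebius_function_norm_lt_1[of "- (- t)" s 0] disc_shift_minus[OF t that] t that
    by (simp_all only: m_def norm_minus_cancel)
  have m_t: "m t = 0"
    by (simp add: m_def Moebius_function_eq_zero)
  have m_hol: "m holomorphic_on unit_disc"
    unfolding m_def using t by (intro Moebius_function_holomorphic) simp
  have shift: "(\<lambda>s. disc_shift c (f (m s))) holomorphic_on unit_disc"
    "\<And>s. cmod s < 1 \<Longrightarrow> cmod (disc_shift c (f (m s))) \<le> 1"
    if "cmod c < 1" "f holomorphic_on unit_disc" "\<And>s. cmod s < 1 \<Longrightarrow> cmod (f s) < 1" for c f
  proof -
    have "disc_shift c \<circ> (f \<circ> m) holomorphic_on unit_disc"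
      using that m m_hol
      by (intro holomorphic_on_compose_gen[OF _ Moebius_function_holomorphic]
          holomorphic_on_compose_gen[OF _ that(2)]) auto
    then show "(\<lambda>s. disc_shift c (f (m s))) holomorphic_on unit_disc"
      by (simp add: o_def)
    show "cmod (disc_shift c (f (m s))) \<le> 1" if "cmod s < 1" for s
      using \<open>cmod c < 1\<close> \<open>\<And>s. cmod s < 1 \<Longrightarrow> cmod (f s) < 1\<close> m that
      by (intro less_imp_le Moebius_function_norm_lt_1) auto
  qed
  show thesis
  proof
    show "tri b3 b1 b2 0 (disc_shift c1 (f1 (m s))) (disc_shift c2 (f2 (m s))) s = 0" if "cmod s < 1" for s
      using g[OF f1 f2, of "m s" "m s" "m s"] fz[of "m s"] m that by simp
    show "(\<lambda>s. disc_shift c1 (f1 (m s))) holomorphic_on unit_disc"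
      "(\<lambda>s. disc_shift c2 (f2 (m s))) holomorphic_on unit_disc"
      using shift(1)[OF c1 f(1) f1] shift(1)[OF c2 f(2) f2] by simp_all
    show "cmod (disc_shift c1 (f1 (m s))) \<le> 1" "cmod (disc_shift c2 (f2 (m s))) \<le> 1"
      if "cmod s < 1" for s
      using shift(2)[OF c1 f(1) f1 that] shift(2)[OF c2 f(2) f2 that] by simp_all
  qed (simp_all only: m_t f(3,4) disc_shift_0)
qed

text \<open>A value of modulus 1 at an interior point forces the function to be constant by the
  maximum principle and cannot be moved to 0, hence the separate cases.\<close>

lemma tri_interpolation:
  assumes "cmod c1 \<le> 1" "cmod c2 \<le> 1" "cmod t < 1" "tri b3 b1 b2 0 c1 c2 t = 0"
  obtains h1 h2 where "h1 holomorphic_on unit_disc" "h2 holomorphic_on unit_disc" "h1 t = c1" "h2 t = c2"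
    "\<And>s. cmod s < 1 \<Longrightarrow> cmod (h1 s) \<le> 1" "\<And>s. cmod s < 1 \<Longrightarrow> cmod (h2 s) \<le> 1"
    "\<And>s. cmod s < 1 \<Longrightarrow> tri b3 b1 b2 0 (h1 s) (h2 s) s = 0"
proof -
  consider "cmod c1 = 1" | "cmod c2 = 1" | "cmod c1 < 1" "cmod c2 < 1"
    using assms by linarith
  then show thesis
  proof cases
    case 1
    obtain h where "h holomorphic_on unit_disc" "h t = c2"
      "\<And>s. cmod s < 1 \<Longrightarrow> cmod (h s) \<le> 1" "\<And>s. cmod s < 1 \<Longrightarrow> tri b3 b1 b2 0 c1 (h s) s = 0"
      using tri_interpolation_unimodular[OF 1 assms(2-4)] by metis
    then show thesis
      using assms(1) by (intro that[of "\<lambda>_. c1" h]) auto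
  next
    case 2
    have "tri b3 b2 b1 0 c2 c1 t = 0"
      using assms(4) by (simp only: tri_swap12[of b3 b2])
    from tri_interpolation_unimodular[OF 2 assms(1,3) this]
    obtain h where "h holomorphic_on unit_disc" "h t = c1"
      "\<And>s. cmod s < 1 \<Longrightarrow> cmod (h s) \<le> 1" "\<And>s. cmod s < 1 \<Longrightarrow> tri b3 b2 b1 0 c2 (h s) s = 0"
      by metis
    then show thesis
      using assms(2) by (intro that[of h "\<lambda>_. c2"]) (auto simp: tri_swap12[of b3 b1])
  next
    case 3
    then show thesis
      using tri_interpolation_interior[OF _ _ assms(3,4)] that by metis
  qed
qed

section \<open>Discs joining two points of the zero set\<close>

definition disc_map :: "(complex \<Rightarrow> complex) \<Rightarrow> bool" where
  "disc_map f \<longleftrightarrow> f holomorphic_on unit_disc \<and> (\<forall>s. cmod s < 1 \<longrightarrow> cmod (f s) < 1)"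

lemma disc_map_Schwarz:
  assumes "h holomorphic_on unit_disc" "\<And>s. cmod s < 1 \<Longrightarrow> cmod (h s) \<le> 1"
  shows "disc_map (\<lambda>s. s * h s)"
  unfolding disc_map_def
proof (intro conjI allI impI)
  show "(\<lambda>s. s * h s) holomorphic_on unit_disc"
    using assms(1) by (intro holomorphic_intros)
  show "cmod (s * h s) < 1" if "cmod s < 1" for s
  proof -
    have "cmod s * cmod (h s) \<le> cmod s"
      using assms(2)[OF that] by (intro mult_left_le) auto
    then show ?thesis using that by (simp add: norm_mult)
  qed
qed

text \<open>The largest coordinate serves as the parameter, so the quotients \<open>w1 / w3\<close>
  and \<open>w2 / w3\<close> to be interpolated lie in the closed disc.\<close>

lemma tri_geodesic_max3:
  assumes "cmod w3 < 1" "cmod w1 \<le> cmod w3" "cmod w2 \<le> cmod w3" "tri 0 b1 b2 b3 w1 w2 w3 = 0"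
  obtains f1 f2 f3 where "disc_map f1" "disc_map f2" "disc_map f3" "f1 0 = 0" "f2 0 = 0" "f3 0 = 0"
    "f1 w3 = w1" "f2 w3 = w2" "f3 w3 = w3"
    "\<And>s. cmod s < 1 \<Longrightarrow> tri 0 b1 b2 b3 (f1 s) (f2 s) (f3 s) = 0"
proof (cases "w3 = 0")
  case True
  with assms show thesis
    by (intro that[of "\<lambda>_. 0" "\<lambda>_. 0" "\<lambda>_. 0"]) (auto simp: disc_map_def tri_def)
next
  case False
  \<comment> \<open>Dividing by \<open>s\<close> stays in the class: \<open>b3\<close> becomes the
    constant coefficient and the third linear coefficient becomes 0.\<close>
  have factor: "tri 0 b1 b2 b3 (s * x) (s * y) s = s * tri b3 b1 b2 0 x y s" for x y s
    by (simp add: tri_def algebra_simps)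
  have "w3 * tri b3 b1 b2 0 (w1 / w3) (w2 / w3) w3 = 0"
    using factor[of w3 "w1 / w3" "w2 / w3"] False assms(4) by simp
  then have "tri b3 b1 b2 0 (w1 / w3) (w2 / w3) w3 = 0"
    using False by simp
  moreover have "cmod (w1 / w3) \<le> 1" "cmod (w2 / w3) \<le> 1"
    using assms False by (simp_all add: norm_divide)
  ultimately obtain h1 h2 where h: "h1 holomorphic_on unit_disc" "h2 holomorphic_on unit_disc"
    "h1 w3 = w1 / w3" "h2 w3 = w2 / w3"
    "\<And>s. cmod s < 1 \<Longrightarrow> cmod (h1 s) \<le> 1" "\<And>s. cmod s < 1 \<Longrightarrow> cmod (h2 s) \<le> 1"
    "\<And>s. cmod s < 1 \<Longrightarrow> tri b3 b1 b2 0 (h1 s) (h2 s) s = 0"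
    using tri_interpolation assms(1) by metis
  have "disc_map (\<lambda>s. s)"
    by (simp add: disc_map_def)
  then show thesis
    using h False
    by (intro that[of "\<lambda>s. s * h1 s" "\<lambda>s. s * h2 s" "\<lambda>s. s"]) (auto simp: factor intro: disc_map_Schwarz)
qed

lemma tri_geodesic_from_origin:
  assumes "cmod w1 < 1" "cmod w2 < 1" "cmod w3 < 1" "tri 0 b1 b2 b3 w1 w2 w3 = 0"
  obtains f1 f2 f3 t where "disc_map f1" "disc_map f2" "disc_map f3" "f1 0 = 0" "f2 0 = 0" "f3 0 = 0"
    "t = w1 \<or> t = w2 \<or> t = w3" "f1 t = w1" "f2 t = w2" "f3 t = w3"
    "\<And>s. cmod s < 1 \<Longrightarrow> tri 0 b1 b2 b3 (f1 s) (f2 s) (f3 s) = 0"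
proof -
  consider "cmod w1 \<le> cmod w3" "cmod w2 \<le> cmod w3" | "cmod w1 \<le> cmod w2" "cmod w3 \<le> cmod w2"
    | "cmod w2 \<le> cmod w1" "cmod w3 \<le> cmod w1"
    by linarith
  then show thesis
  proof cases
    case 1
    then show thesis
      using tri_geodesic_max3[OF assms(3) 1 assms(4)] that by metis
  next
    case 2
    have swap: "tri 0 b1 b2 b3 x y z = tri 0 b1 b3 b2 x z y" for x y z
      by (simp add: tri_def algebra_simps)
    obtain f1 f2 f3 where "disc_map f1" "disc_map f2" "disc_map f3" "f1 0 = 0" "f2 0 = 0" "f3 0 = 0"
      "f1 w2 = w1" "f2 w2 = w3" "f3 w2 = w2"
      "\<And>s. cmod s < 1 \<Longrightarrow> tri 0 b1 b3 b2 (f1 s) (f2 s) (f3 s) = 0"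
      using tri_geodesic_max3[OF assms(2) 2] assms(4) unfolding swap by metis
    then show thesis
      by (intro that[of f1 f3 f2 w2]) (auto simp: swap)
  next
    case 3
    obtain f1 f2 f3 where "disc_map f1" "disc_map f2" "disc_map f3" "f1 0 = 0" "f2 0 = 0" "f3 0 = 0"
      "f1 w1 = w3" "f2 w1 = w2" "f3 w1 = w1"
      "\<And>s. cmod s < 1 \<Longrightarrow> tri 0 b3 b2 b1 (f1 s) (f2 s) (f3 s) = 0"
      using tri_geodesic_max3[OF assms(1) 3(2,1)] assms(4) unfolding tri_swap13[of 0 b1] by metis
    then show thesis
      by (intro that[of f3 f2 f1 w1]) (auto simp: tri_swap13[of 0 b1])
  qed
qed

lemma disc_map_shift:
  assumes "disc_map f" "cmod p < 1"
  shows "disc_map (\<lambda>s. disc_shift p (f s))"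
proof -
  have "disc_shift p \<circ> f holomorphic_on unit_disc"
    using assms by (intro holomorphic_on_compose_gen[OF _ Moebius_function_holomorphic]) (auto simp: disc_map_def)
  moreover have "cmod (disc_shift p (f s)) < 1" if "cmod s < 1" for s
    using assms that by (intro Moebius_function_norm_lt_1) (auto simp: disc_map_def)
  ultimately show ?thesis
    by (simp add: disc_map_def o_def)
qed

text \<open>Moving (z1, z2, z3) to the origin preserves the coordinate distances. Equality with any
  one of them suffices, since each is a lower bound for the Caratheodory distance of the
  polydisc.\<close>

lemma tri_geodesic:
  assumes z: "cmod z1 < 1" "cmod z2 < 1" "cmod z3 < 1" and w: "cmod w1 < 1" "cmod w2 < 1" "cmod w3 < 1"
    and zeros: "tri a b1 b2 b3 z1 z2 z3 = 0" "tri a b1 b2 b3 w1 w2 w3 = 0"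
  obtains f1 f2 f3 t where "disc_map f1" "disc_map f2" "disc_map f3" "f1 0 = z1" "f2 0 = z2" "f3 0 = z3"
    "f1 t = w1" "f2 t = w2" "f3 t = w3" "cmod t < 1"
    "poincare_dist 0 t \<in> {poincare_dist z1 w1, poincare_dist z2 w2, poincare_dist z3 w3}"
    "\<And>s. cmod s < 1 \<Longrightarrow> tri a b1 b2 b3 (f1 s) (f2 s) (f3 s) = 0"
proof -
  obtain c1 c2 c3 where c: "\<And>x y z. cmod x < 1 \<Longrightarrow> cmod y < 1 \<Longrightarrow> cmod z < 1 \<Longrightarrow>
    tri a b1 b2 b3 (disc_shift z1 x) (disc_shift z2 y) (disc_shift z3 z) = 0 \<longleftrightarrow> tri 0 c1 c2 c3 x y z = 0"
    using tri_shift_zeros[OF z zeros(1)] by metis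
  define v1 v2 v3 where "v1 = disc_shift (- z1) w1" and "v2 = disc_shift (- z2) w2"
    and "v3 = disc_shift (- z3) w3"
  have v: "cmod v1 < 1" "cmod v2 < 1" "cmod v3 < 1"
    using z w by (auto simp: v1_def v2_def v3_def intro!: Moebius_function_norm_lt_1)
  have vw: "disc_shift z1 v1 = w1" "disc_shift z2 v2 = w2" "disc_shift z3 v3 = w3"
    using z w by (simp_all only: v1_def v2_def v3_def disc_shift_minus)
  have "tri 0 c1 c2 c3 v1 v2 v3 = 0"
    using c[OF v] zeros(2) vw by simp
  from tri_geodesic_from_origin[OF v this]
  obtain f1 f2 f3 t where f: "disc_map f1" "disc_map f2" "disc_map f3" "f1 0 = 0" "f2 0 = 0" "f3 0 = 0"
    "t = v1 \<or> t = v2 \<or> t = v3" "f1 t = v1" "f2 t = v2" "f3 t = v3"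
    "\<And>s. cmod s < 1 \<Longrightarrow> tri 0 c1 c2 c3 (f1 s) (f2 s) (f3 s) = 0"
    by metis
  show thesis
  proof
    show "tri a b1 b2 b3 (disc_shift z1 (f1 s)) (disc_shift z2 (f2 s)) (disc_shift z3 (f3 s)) = 0"
      if "cmod s < 1" for s
      using f(1-3,11) c that by (auto simp: disc_map_def)
    show "poincare_dist 0 t \<in> {poincare_dist z1 w1, poincare_dist z2 w2, poincare_dist z3 w3}"
      using f(7) by (auto simp: poincare_dist_0 poincare_dist_eq_disc_shift[of _ w1]
        poincare_dist_eq_disc_shift[of _ w2] poincare_dist_eq_disc_shift[of _ w3] v1_def v2_def v3_def)
    show "cmod t < 1"
      using f(7) v by auto
  qed (simp_all only: f(4-6,8-10) vw disc_shift_0 disc_map_shift[OF f(1) z(1)]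
      disc_map_shift[OF f(2) z(2)] disc_map_shift[OF f(3) z(3)])
qed

section \<open>Several complex variables and comparison of the distances\<close>

lemma mv_holomorphic_on_const: "mv_holomorphic_on (\<lambda>_. c) W"
  unfolding mv_holomorphic_on_def by (intro ballI exI[of _ "\<lambda>_. 0"]) auto

lemma mv_holomorphic_on_nth: "mv_holomorphic_on (\<lambda>z. z $ k) W"
  unfolding mv_holomorphic_on_def
  by (intro ballI exI[of _ "\<lambda>z. z $ k"] conjI bounded_linear_imp_has_derivative bounded_linear_vec_nth)
    simp

lemma mv_holomorphic_on_add:
  assumes "mv_holomorphic_on f W" "mv_holomorphic_on g W"
  shows "mv_holomorphic_on (\<lambda>z. f z + g z) W"
  unfolding mv_holomorphic_on_def
proof
  fix x assume "x \<in> W"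
  with assms obtain L M where "(f has_derivative L) (at x)" "\<forall>c v. L (c *s v) = c * L v"
    "(g has_derivative M) (at x)" "\<forall>c v. M (c *s v) = c * M v"
    unfolding mv_holomorphic_on_def by metis
  then show "\<exists>L. ((\<lambda>z. f z + g z) has_derivative L) (at x) \<and> (\<forall>c v. L (c *s v) = c * L v)"
    by (intro exI[of _ "\<lambda>v. L v + M v"]) (auto intro: has_derivative_add simp: distrib_left)
qed

lemma mv_holomorphic_on_mult:
  assumes "mv_holomorphic_on f W" "mv_holomorphic_on g W"
  shows "mv_holomorphic_on (\<lambda>z. f z * g z) W"
  unfolding mv_holomorphic_on_def
proof
  fix x assume "x \<in> W"
  with assms obtain L M where "(f has_derivative L) (at x)" "\<forall>c v. L (c *s v) = c * L v"
    "(g has_derivative M) (at x)" "\<forall>c v. M (c *s v) = c * M v"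
    unfolding mv_holomorphic_on_def by metis
  then show "\<exists>L. ((\<lambda>z. f z * g z) has_derivative L) (at x) \<and> (\<forall>c v. L (c *s v) = c * L v)"
    by (intro exI[of _ "\<lambda>v. f x * M v + L v * g x"] conjI has_derivative_mult) (auto simp: algebra_simps)
qed

lemma mv_holomorphic_on_diff:
  assumes "mv_holomorphic_on f W" "mv_holomorphic_on g W"
  shows "mv_holomorphic_on (\<lambda>z. f z - g z) W"
  using mv_holomorphic_on_add[OF assms(1) mv_holomorphic_on_mult[OF mv_holomorphic_on_const assms(2)], of "-1"]
  by simp

text \<open>\<open>F\<close> is differentiable only through its local extensions \<open>g\<close>,
  so the chain rule is applied to \<open>g\<close>; complex linearity of its derivative makes the
  composition holomorphic.\<close>

lemma holomorphic_on_compose_subset: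
  fixes f :: "complex \<Rightarrow> complex ^ 'n"
  assumes F: "holomorphic_on_subset D V F"
    and f: "\<And>i. (\<lambda>s. f s $ i) holomorphic_on S" "open S" "f ` S \<subseteq> V"
  shows "(\<lambda>s. F (f s)) holomorphic_on S"
  unfolding holomorphic_on_open[OF \<open>open S\<close>]
proof (intro ballI allI impI)
  fix s assume s: "s \<in> S"
  obtain W g where W: "open W" "f s \<in> W" "mv_holomorphic_on g W" "\<forall>x\<in>V \<inter> W. F x = g x"
    using F f(3) s unfolding holomorphic_on_subset_def by (metis image_subset_iff)
  obtain L where L: "(g has_derivative L) (at (f s))" "\<And>c v. L (c *s v) = c * L v"
    using W(2,3) unfolding mv_holomorphic_on_def by metis
  define v where "v = (\<chi> i. deriv (\<lambda>s. f s $ i) s)"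
  have "(f has_derivative (\<lambda>h. h *s v)) (at s)"
  \<comment> \<open>The basis vectors are real ones, \<open>axis i b\<close> with \<open>b\<close>
    in the real basis of the complex plane.\<close>
  proof (subst has_derivative_componentwise_within, rule ballI)
    fix e :: "complex ^ 'n" assume "e \<in> Basis"
    then obtain i b where e: "e = axis i b"
      by (auto simp: Basis_vec_def)
    have "((\<lambda>s. f s $ i) has_derivative (\<lambda>h. h * v $ i)) (at s)"
      using holomorphic_derivI[OF f(1)[of i] f(2) s]
      by (simp add: has_field_derivative_def v_def mult.commute[of _ "deriv _ _"])
    then have "((\<lambda>s. f s $ i \<bullet> b) has_derivative (\<lambda>h. (h * v $ i) \<bullet> b)) (at s)"
      by (rule has_derivative_inner_left)
    then show "((\<lambda>x. f x \<bullet> e) has_derivative (\<lambda>h. (h *s v) \<bullet> e)) (at s)"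
      by (simp add: e inner_axis)
  qed
  from has_derivative_compose[OF this L(1)]
  have g: "((\<lambda>u. g (f u)) has_field_derivative L v) (at s)"
    by (simp add: has_field_derivative_def L(2) mult.commute[of _ "L v"])
  have "continuous_on S f"
    using f(1) by (intro continuous_on_vec_lambda[where f="\<lambda>i s. f s $ i", simplified]
        holomorphic_on_imp_continuous_on)
  then have "open (S \<inter> f -` W)"
    using f(2) W(1) by (rule continuous_open_preimage)
  then have "((\<lambda>s. F (f s)) has_field_derivative L v) (at s)"
    using g s W(2,4) f(3)
    by (intro has_field_derivative_transform_within_open[OF g, of "S \<inter> f -` W"]) auto
  then show "\<exists>f'. ((\<lambda>s. F (f s)) has_field_derivative f') (at s)" ..
qed

text \<open>Schwarz-Pick for the composition of a competitor \<open>F\<close> with a disc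
  \<open>f\<close> in \<open>V\<close>.\<close>

lemma caratheodory_dist_le_lempert_fun:
  fixes z w :: "complex ^ 'n"
  shows "caratheodory_dist D V z w \<le> lempert_fun V z w"
  unfolding caratheodory_dist_def lempert_fun_def
proof (rule SUP_least, rule Inf_greatest)
  fix F d
  assume F: "F \<in> hol_to_disc D V"
    and "d \<in> {ereal (poincare_dist 0 t) | t. t \<in> unit_disc \<and>
       (\<exists>f :: complex \<Rightarrow> complex ^ 'n. (\<forall>i. (\<lambda>s. f s $ i) holomorphic_on unit_disc) \<and>
          f ` unit_disc \<subseteq> V \<and> f 0 = z \<and> f t = w)}"
  then obtain t and f :: "complex \<Rightarrow> complex ^ 'n" where d: "d = ereal (poincare_dist 0 t)" and t: "cmod t < 1"
    and f: "\<And>i. (\<lambda>s. f s $ i) holomorphic_on unit_disc" "f ` unit_disc \<subseteq> V" "f 0 = z" "f t = w"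
    by auto
  have F_hol: "holomorphic_on_subset D V F" and F_disc: "F ` V \<subseteq> unit_disc"
    using F by (simp_all add: hol_to_disc_def)
  have "(\<lambda>s. F (f s)) holomorphic_on unit_disc"
    by (rule holomorphic_on_compose_subset[OF F_hol f(1) open_ball f(2)])
  moreover have "(\<lambda>s. F (f s)) ` unit_disc \<subseteq> unit_disc"
    using F_disc f(2) by (simp only: image_subset_iff) blast
  ultimately have "poincare_dist (F (f 0)) (F (f t)) \<le> poincare_dist 0 t"
    by (rule poincare_dist_holomorphic_le[OF _ _ t])
  then show "ereal (poincare_dist (F z) (F w)) \<le> d"
    by (simp add: d f)
qed

lemma caratheodory_dist_mono:
  assumes "V \<subseteq> D"
  shows "caratheodory_dist D D z w \<le> caratheodory_dist D V z w"
proof -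
  have "holomorphic_on_subset D V f" if f: "holomorphic_on_subset D D f" for f
    unfolding holomorphic_on_subset_def
  proof
    fix x assume "x \<in> V"
    then obtain W g where "open W" "x \<in> W" "W \<subseteq> D" "mv_holomorphic_on g W" "\<forall>x\<in>D \<inter> W. f x = g x"
      using assms f unfolding holomorphic_on_subset_def by (meson subsetD)
    then show "\<exists>W g. open W \<and> x \<in> W \<and> W \<subseteq> D \<and> mv_holomorphic_on g W \<and> (\<forall>x\<in>V \<inter> W. f x = g x)"
      using assms by (intro exI[of _ W] exI[of _ g]) auto
  qed
  then have "hol_to_disc D D \<subseteq> hol_to_disc D V"
    using assms by (auto simp: hol_to_disc_def)
  then show ?thesis
    unfolding caratheodory_dist_def by (rule SUP_subset_mono) simp
qed

section \<open>The polydisc and the variety\<close>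

lemma open_polydisc: "open polydisc"
  unfolding polydisc_def by (rule open_vector_box) simp

lemma convex_polydisc: "convex polydisc"
  unfolding polydisc_def by (rule convex_box_cart) (simp only: Collect_mem_eq convex_ball)

text \<open>Coordinate functions compete in the supremum.\<close>

lemma poincare_dist_nth_le_caratheodory_dist:
  "ereal (poincare_dist (z $ k) (w $ k)) \<le> caratheodory_dist polydisc polydisc z w"
proof -
  have "(\<lambda>z. z $ k) \<in> hol_to_disc polydisc polydisc"
    unfolding hol_to_disc_def holomorphic_on_subset_def
    using open_polydisc mv_holomorphic_on_nth[of k polydisc] by (auto simp: polydisc_def)
  then show ?thesis
    unfolding caratheodory_dist_def by (rule SUP_upper2) simp
qed

lemma M_set_tri:
  "M_set \<alpha> = {z \<in> polydisc. tri 0 (\<alpha> $ 1) (\<alpha> $ 2) (\<alpha> $ 3) (z $ 1) (z $ 2) (z $ 3) = 0}"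
  unfolding M_set_def tri_def by simp

lemma analytic_subset_M_set: "analytic_subset polydisc (M_set \<alpha>)"
proof -
  define Q where "Q z = tri 0 (\<alpha> $ 1) (\<alpha> $ 2) (\<alpha> $ 3) (z $ 1) (z $ 2) (z $ 3)" for z :: "complex ^ 3"
  have "mv_holomorphic_on Q polydisc"
    unfolding Q_def tri_def
    by (intro mv_holomorphic_on_add mv_holomorphic_on_diff mv_holomorphic_on_mult
        mv_holomorphic_on_const mv_holomorphic_on_nth)
  moreover have "M_set \<alpha> \<inter> polydisc = {z \<in> polydisc. \<forall>g\<in>{Q}. g z = 0}"
    by (auto simp: M_set_tri Q_def)
  ultimately show ?thesis
    unfolding analytic_subset_def
    by (intro conjI ballI exI[of _ polydisc] exI[of _ "{Q}"]) (auto simp: open_polydisc M_set_def)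
qed

text \<open>This closes the chain of inequalities: the disc from \<open>tri_geodesic\<close>
  realises a coordinate distance.\<close>

lemma lempert_fun_M_set_le:
  assumes "z \<in> M_set \<alpha>" "w \<in> M_set \<alpha>"
  shows "lempert_fun (M_set \<alpha>) z w \<le> caratheodory_dist polydisc polydisc z w"
proof -
  let ?Q = "tri 0 (\<alpha> $ 1) (\<alpha> $ 2) (\<alpha> $ 3)"
  have z: "cmod (z $ i) < 1" and w: "cmod (w $ i) < 1" for i
    using assms by (auto simp: M_set_def polydisc_def)
  have zw: "?Q (z $ 1) (z $ 2) (z $ 3) = 0" "?Q (w $ 1) (w $ 2) (w $ 3) = 0"
    using assms by (auto simp: M_set_tri)
  obtain f1 f2 f3 t where f: "disc_map f1" "disc_map f2" "disc_map f3"
    "f1 0 = z $ 1" "f2 0 = z $ 2" "f3 0 = z $ 3" "f1 t = w $ 1" "f2 t = w $ 2" "f3 t = w $ 3" "cmod t < 1"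
    and t: "poincare_dist 0 t \<in> {poincare_dist (z $ 1) (w $ 1), poincare_dist (z $ 2) (w $ 2),
      poincare_dist (z $ 3) (w $ 3)}"
    and Q: "\<And>s. cmod s < 1 \<Longrightarrow> ?Q (f1 s) (f2 s) (f3 s) = 0"
    using tri_geodesic[OF z z z w w w zw] by metis
  define f :: "complex \<Rightarrow> complex ^ 3" where "f s = vector [f1 s, f2 s, f3 s]" for s
  have "\<forall>i. (\<lambda>s. f s $ i) holomorphic_on unit_disc"
    using f by (simp add: forall_3 f_def disc_map_def)
  moreover have "f ` unit_disc \<subseteq> M_set \<alpha>"
    using f Q by (auto simp: M_set_tri polydisc_def forall_3 f_def disc_map_def)
  moreover have "f 0 = z" "f t = w"
    using f by (simp_all add: vec_eq_iff forall_3 f_def)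
  ultimately have "lempert_fun (M_set \<alpha>) z w \<le> ereal (poincare_dist 0 t)"
    unfolding lempert_fun_def using \<open>cmod t < 1\<close> by (intro Inf_lower) auto
  also have "\<dots> \<le> caratheodory_dist polydisc polydisc z w"
    using t poincare_dist_nth_le_caratheodory_dist[of z _ w] by auto
  finally show ?thesis .
qed

theorem theorem14:
  fixes \<alpha> :: "complex ^ 3"
  assumes "\<alpha> \<noteq> 0"
  shows "caratheodory_set polydisc (M_set \<alpha>) \<and>
    (\<forall>z\<in>M_set \<alpha>. \<forall>w\<in>M_set \<alpha>.
       lempert_fun (M_set \<alpha>) z w = caratheodory_dist polydisc (M_set \<alpha>) z w \<and>
       caratheodory_dist polydisc (M_set \<alpha>) z w = caratheodory_dist polydisc polydisc z w)"
proof -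
  have "caratheodory_dist polydisc polydisc z w \<le> caratheodory_dist polydisc (M_set \<alpha>) z w" for z w
    by (rule caratheodory_dist_mono) (auto simp: M_set_def)
  then have eq: "lempert_fun (M_set \<alpha>) z w = caratheodory_dist polydisc (M_set \<alpha>) z w \<and>
      caratheodory_dist polydisc (M_set \<alpha>) z w = caratheodory_dist polydisc polydisc z w"
    if "z \<in> M_set \<alpha>" "w \<in> M_set \<alpha>" for z w
    using lempert_fun_M_set_le[OF that] caratheodory_dist_le_lempert_fun[of polydisc "M_set \<alpha>" z w]
    by (meson order.antisym order.trans)
  have "0 \<in> (polydisc :: (complex ^ 3) set)"
    by (simp add: polydisc_def)
  then have "caratheodory_set polydisc (M_set \<alpha>)"
    unfolding caratheodory_set_def
    using eq open_polydisc convex_connected[OF convex_polydisc] analytic_subset_M_set by auto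
  with eq show ?thesis by blast
qed

end
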